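(* Let $F$ be a Ferrers diagram, $G=G(F)$ the corresponding Ferrers graph, and $<_E$ an $F$-compatible total order on the edges of $G$. Let $\mathcal{T}$ be a dotted tableau of shape $F$. Then $\mathcal{T}$ is a tree-tableau if and only if $S(\mathcal{T})$ is a spanning tree of $G$ with external activity $0$ (with respect to $<_E$).
   Context: A Ferrers diagram is a left-aligned array of cells whose row lengths weakly decrease from top to bottom (all rows nonempty). The Ferrers graph $G(F)$ is the bipartite graph whose vertices are the rows and the columns of $F$, with an edge joining a row and a column iff $F$ has a cell in that row and column; cells of $F$ are thereby identified with edges of $G(F)$. A dotted tableau of shape $F$ is a filling of $F$ in which each cell is either empty or contains a single dot. $S(\mathcal{T})$ is the subgraph of $G(F)$ with all vertices of $G(F)$ and with exactly the edges corresponding to dotted cells of $\mathcal{T}$. A tree-tableau is a dotted tableau such that (1) the top left cell has a dot; (2) every other dotted cell has a dot above it in the same column or a dot to its left in the same row, but not both; (3) every row and every column has a dot. A total order $<_E$ on the edges of $G$ (equivalently, on the cells of $F$) is $F$-compatible if it is increasing in every row from left to right and in every column from top to bottom of $F$. For a spanning tree $S$ of $G$ and an edge $e\notin S$, $e$ is externally active if it is the minimal edge, for $<_E$, in the unique cycle of $S\cup\{e\}$. The external activity of $S$ is its number of externally active edges. *)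

theory Defs
  imports "Graph_Theory.Graph_Theory"
begin

section \<open>Ferrers diagrams and dotted tableaux\<close>

text \<open>
  A Ferrers diagram is given by its list of row lengths, from top to bottom. Rows and columns are
  numbered from 0, and the cell \<open>(i, j)\<close> lies in row \<open>i\<close> and column \<open>j\<close>.
\<close>

type_synonym cell = "nat \<times> nat"

definition ferrers_diagram :: "nat list \<Rightarrow> bool" where
  "ferrers_diagram F \<longleftrightarrow> sorted_wrt (\<ge>) F \<and> (\<forall>l\<in>set F. 0 < l)"

definition cells :: "nat list \<Rightarrow> cell set" where
  "cells F = {(i, j). i < length F \<and> j < F ! i}"

definition rows :: "nat list \<Rightarrow> nat set" where
  "rows F = {..<length F}"

definition columns :: "nat list \<Rightarrow> nat set" where
  "columns F = snd ` cells F"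

text \<open>A dotted tableau is represented by the set of its dotted cells.\<close>

definition dotted_tableau :: "nat list \<Rightarrow> cell set \<Rightarrow> bool" where
  "dotted_tableau F T \<longleftrightarrow> T \<subseteq> cells F"

definition dot_above :: "cell set \<Rightarrow> cell \<Rightarrow> bool" where
  "dot_above T c \<longleftrightarrow> (\<exists>i<fst c. (i, snd c) \<in> T)"

definition dot_left :: "cell set \<Rightarrow> cell \<Rightarrow> bool" where
  "dot_left T c \<longleftrightarrow> (\<exists>j<snd c. (fst c, j) \<in> T)"

definition tree_tableau :: "nat list \<Rightarrow> cell set \<Rightarrow> bool" where
  "tree_tableau F T \<longleftrightarrow>
     dotted_tableau F T \<and>
     (0, 0) \<in> T \<and>
     (\<forall>c\<in>T. c \<noteq> (0, 0) \<longrightarrow>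
        (dot_above T c \<or> dot_left T c) \<and> \<not> (dot_above T c \<and> dot_left T c)) \<and>
     (\<forall>i\<in>rows F. \<exists>j. (i, j) \<in> T) \<and>
     (\<forall>j\<in>columns F. \<exists>i. (i, j) \<in> T)"


section \<open>Cycles and spanning trees of undirected graphs\<close>

text \<open>
  Undirected graphs are symmetric digraphs (cf.\ \<^locale>\<open>pair_graph\<close>): an edge is a pair of
  opposite arcs. The notions \<^const>\<open>forest\<close>, \<^const>\<open>tree\<close> and \<^const>\<open>spanning_tree\<close> of the
  library refer to directed cycles; going back and forth along an edge is such a cycle, of length 2.
  Excluding it leaves exactly the cycles of the undirected graph. Note that
  \<^const>\<open>Digraph_Component.connected\<close> requires a vertex, so the empty graph is not a tree.
\<close>

definition undirected_cycle :: "'a pair_pre_digraph \<Rightarrow> ('a \<times> 'a) awalk \<Rightarrow> bool" where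
  "undirected_cycle G p \<longleftrightarrow> pre_digraph.cycle (with_proj G) p \<and> 3 \<le> length p"

definition undirected_tree :: "'a pair_pre_digraph \<Rightarrow> bool" where
  "undirected_tree G \<longleftrightarrow>
     Digraph_Component.connected (with_proj G) \<and> (\<nexists>p. undirected_cycle G p)"

definition undirected_spanning_tree :: "'a pair_pre_digraph \<Rightarrow> 'a pair_pre_digraph \<Rightarrow> bool" where
  "undirected_spanning_tree S G \<longleftrightarrow>
     undirected_tree S \<and> spanning (with_proj S) (with_proj G)"


section \<open>Ferrers graphs\<close>

datatype vertex = Row nat | Col nat

definition tableau_graph :: "nat list \<Rightarrow> cell set \<Rightarrow> vertex pair_pre_digraph" where
  "tableau_graph F T =
     \<lparr> pverts = Row ` rows F \<union> Col ` columns F,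
       parcs = (\<Union>(i, j)\<in>T. {(Row i, Col j), (Col j, Row i)}) \<rparr>"

definition ferrers_graph :: "nat list \<Rightarrow> vertex pair_pre_digraph" where
  "ferrers_graph F = tableau_graph F (cells F)"

lemma pair_graph_tableau_graph:
  assumes "dotted_tableau F T"
  shows "pair_graph (tableau_graph F T)"
proof -
  have "cells F = Sigma {..<length F} (\<lambda>i. {..<F ! i})"
    by (auto simp: cells_def)
  then have fin: "finite (cells F)"
    by simp
  with assms have "finite T"
    by (auto simp: dotted_tableau_def intro: finite_subset)
  with fin assms show ?thesis
    by unfold_locales
      (auto simp: tableau_graph_def dotted_tableau_def rows_def columns_def cells_def
        symmetric_def sym_def image_iff)
qed


section \<open>External activity\<close>

text \<open>Edges of the Ferrers graph are identified with cells, and edge orders are strict.\<close>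

definition F_compatible :: "nat list \<Rightarrow> cell rel \<Rightarrow> bool" where
  "F_compatible F R \<longleftrightarrow>
     (\<forall>i j j'. (i, j) \<in> cells F \<and> (i, j') \<in> cells F \<and> j < j' \<longrightarrow> ((i, j), (i, j')) \<in> R) \<and>
     (\<forall>i i' j. (i, j) \<in> cells F \<and> (i', j) \<in> cells F \<and> i < i' \<longrightarrow> ((i, j), (i', j)) \<in> R)"

definition walk_cells :: "(vertex \<times> vertex) awalk \<Rightarrow> cell set" where
  "walk_cells p = {(i, j). (Row i, Col j) \<in> set p \<or> (Col j, Row i) \<in> set p}"

text \<open>
  A cycle is unique only up to its starting point and orientation, hence the unique cycle of
  \<open>S \<union> {e}\<close> is taken as a set of edges.
\<close>

definition fundamental_cycle :: "nat list \<Rightarrow> cell set \<Rightarrow> cell \<Rightarrow> cell set" where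
  "fundamental_cycle F T e =
     (THE C. \<exists>p. undirected_cycle (tableau_graph F (insert e T)) p \<and> C = walk_cells p)"

definition externally_active :: "nat list \<Rightarrow> cell rel \<Rightarrow> cell set \<Rightarrow> cell \<Rightarrow> bool" where
  "externally_active F R T e \<longleftrightarrow>
     e \<in> cells F - T \<and>
     e \<in> fundamental_cycle F T e \<and> (\<forall>c\<in>fundamental_cycle F T e - {e}. (e, c) \<in> R)"

definition external_activity :: "nat list \<Rightarrow> cell rel \<Rightarrow> cell set \<Rightarrow> nat" where
  "external_activity F R T = card {e. externally_active F R T e}"

end

theory Submission
  imports Defs
begin

text \<open>
  In a tableau where no dot has both a dot above it and a dot to its left, every dot is the first one
  of its row or the first one of its column. Call the vertex of the column the parent of the vertex
  of the row in the former case, and conversely in the latter. Every vertex that has a dot then has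
  a parent, and following parents moves up and to the left, until a dot is reached that is first in
  its row and first in its column. In a tree-tableau only the top left cell is such a dot, so the
  dots form a single tree grown from the edge \<open>(0, 0)\<close>.

  Let \<open>T\<close> be a tree-tableau and let \<open>(i, j)\<close> be any cell. Going up the tree from row \<open>i\<close> meets
  only rows up to \<open>i\<close>, going up from column \<open>j\<close> only columns up to \<open>j\<close>, and the path between the
  two vertices consists of these two ascents up to the vertex where they meet. If this is a row \<open>r\<close>,
  then \<open>r \<le> i\<close>, and the ascent from column \<open>j\<close> reaches it from a column \<open>c \<le> j\<close>, so the path contains
  the dot \<open>(r, c)\<close> weakly above and weakly to the left of \<open>(i, j)\<close>; if they meet in a column, the
  ascent from row \<open>i\<close> supplies such a dot. The lemma \<open>quadrant_separates\<close> states this as a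
  separation property, so that no path has to be handled. It gives both acyclicity and external
  inactivity. A cycle of dots has a dot with no other dot of the cycle weakly above and weakly to its
  left, although the other dots of the cycle connect its ends. And the fundamental cycle of an
  undotted cell \<open>e\<close> contains a dot weakly above and weakly to the left of \<open>e\<close>, which precedes \<open>e\<close> in
  every compatible order, because its row and the column of \<open>e\<close> meet in a cell of the diagram.

  Conversely, let the dots form a spanning tree without externally active edges. The cell \<open>(0, 0)\<close>
  is minimal for the order, so it would be active if it had no dot. If some dot had both a dot above
  and a dot to its left, the three would be corners of a rectangle whose fourth, top left corner has
  no dot by acyclicity and is active, the rectangle being its fundamental cycle. Hence every dot
  is first in its row or column, and it remains to see that only \<open>(0, 0)\<close> is both. Each dot that
  is both has its own tree of descendants, and no dot joins two such trees, so connectedness leaves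
  room for one only (\<open>exclusive_connected_imp_supported\<close>).

  Cycles are treated through reachability: the ends of any edge of a cycle are linked by the rest
  of the cycle, and conversely an edge whose ends are linked without it closes a cycle.
\<close>

section \<open>Connectedness in tableau graphs\<close>

text \<open>
  These are the arcs of \<^const>\<open>tableau_graph\<close>. Leaving out the diagram, on which only the vertices
  depend, makes it possible to speak of the connections made by any set of cells.
\<close>

definition edges :: "cell set \<Rightarrow> vertex rel" where
  "edges T = (\<Union>(i, j)\<in>T. {(Row i, Col j), (Col j, Row i)})"

abbreviation linked :: "cell set \<Rightarrow> vertex rel" where
  "linked T \<equiv> (edges T)\<^sup>*"

lemma edges_iff [simp]:
  "(Row i, Col j) \<in> edges T \<longleftrightarrow> (i, j) \<in> T"
  "(Col j, Row i) \<in> edges T \<longleftrightarrow> (i, j) \<in> T"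
  "(Row i, Row i') \<notin> edges T"
  "(Col j, Col j') \<notin> edges T"
  by (auto simp: edges_def)

lemma edges_mono: "S \<subseteq> T \<Longrightarrow> edges S \<subseteq> edges T"
  by (auto simp: edges_def)

lemma linked_mono: "S \<subseteq> T \<Longrightarrow> linked S \<subseteq> linked T"
  by (intro rtrancl_mono edges_mono)

lemma sym_linked: "sym (linked T)"
  by (intro sym_rtrancl) (auto simp: sym_def edges_def)

lemma linked_insert:
  assumes "(Row (fst e), Col (snd e)) \<in> linked S"
  shows "linked (insert e S) \<subseteq> linked S"
proof -
  have "(Col (snd e), Row (fst e)) \<in> linked S"
    using assms sym_linked by (metis symD)
  with assms have "edges (insert e S) \<subseteq> linked S"
    by (auto simp: edges_def)
  then show ?thesis
    using rtrancl_subset_rtrancl by blast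
qed

lemma tableau_graph_simps [simp]:
  "pverts (tableau_graph F T) = Row ` rows F \<union> Col ` columns F"
  "parcs (tableau_graph F T) = edges T"
  by (simp_all add: tableau_graph_def edges_def)

lemma finite_cells: "finite (cells F)"
proof -
  have "cells F = Sigma {..<length F} (\<lambda>i. {..<F ! i})"
    by (auto simp: cells_def)
  then show ?thesis
    by simp
qed

lemma vertices_of_cell:
  assumes "(i, j) \<in> cells F"
  shows "i \<in> rows F" "j \<in> columns F"
  using assms by (force simp: cells_def rows_def columns_def)+

lemma connected_tableau_graph_iff:
  assumes "dotted_tableau F T"
  shows "Digraph_Component.connected (with_proj (tableau_graph F T)) \<longleftrightarrow>
    pverts (tableau_graph F T) \<noteq> {} \<and>
    (\<forall>u\<in>pverts (tableau_graph F T). \<forall>v\<in>pverts (tableau_graph F T). (u, v) \<in> linked T)"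
proof -
  let ?G = "tableau_graph F T"
  interpret pair_graph ?G
    using assms by (rule pair_graph_tableau_graph)
  have "parcs (mk_symmetric (with_proj ?G)) = edges T"
    by (auto simp: mk_symmetric_def edges_def)
  moreover have "pverts (mk_symmetric (with_proj ?G)) = pverts ?G"
    by simp
  ultimately have "mk_symmetric (with_proj ?G) = ?G"
    by (intro pair_pre_digraph.equality) auto
  moreover have "u \<rightarrow>\<^sup>*\<^bsub>with_proj ?G\<^esub> v \<longleftrightarrow> (u, v) \<in> linked T"
    if "u \<in> pverts ?G" "v \<in> pverts ?G" for u v
    using that by (auto simp: reachable_conv arcs_ends_conv)
  ultimately show ?thesis
    unfolding Digraph_Component.connected_def strongly_connected_def by simp
qed

section \<open>Cycles in tableau graphs\<close>

lemma walk_cells_subset: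
  assumes "undirected_cycle (tableau_graph F T) p"
  shows "walk_cells p \<subseteq> T"
  using assms
  by (auto simp: undirected_cycle_def pre_digraph.cycle_def pre_digraph.awalk_def walk_cells_def)

lemma walk_cells_nonempty:
  assumes "undirected_cycle (tableau_graph F T) p"
  shows "walk_cells p \<noteq> {}"
proof -
  have "p \<noteq> []" "set p \<subseteq> edges T"
    using assms
    by (auto simp: undirected_cycle_def pre_digraph.cycle_def pre_digraph.awalk_def)
  then show ?thesis
    by (cases p) (auto simp: walk_cells_def edges_def)
qed

text \<open>
  The arcs of a walk are determined by the cells it uses, so a cycle lives in every tableau that
  has these cells.
\<close>

lemma undirected_cycle_change:
  assumes "undirected_cycle (tableau_graph F T) p" and "walk_cells p \<subseteq> T'"
  shows "undirected_cycle (tableau_graph F T') p"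
proof -
  have "set p \<subseteq> edges T"
    using assms(1)
    by (auto simp: undirected_cycle_def pre_digraph.cycle_def pre_digraph.awalk_def)
  with assms(2) have "set p \<subseteq> edges T'"
    by (force simp: walk_cells_def edges_def)
  with assms(1) show ?thesis
    by (auto simp: undirected_cycle_def pre_digraph.cycle_def pre_digraph.awalk_def
        cas_with_proj_eq awalk_verts_with_proj_eq)
qed

text \<open>
  Rotate the cycle so that it begins with the arc of the given cell. The remaining arcs form a path
  between the ends of that cell. The path does not run back through the cell, since the cycle has
  length at least 3.
\<close>

lemma cycle_avoiding_edge_linked:
  assumes "dotted_tableau F T" and cyc: "undirected_cycle (tableau_graph F T) p"
    and c: "(i, j) \<in> walk_cells p"
  shows "(Row i, Col j) \<in> linked (walk_cells p - {(i, j)})"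
proof -
  let ?G = "tableau_graph F T"
  interpret pair_graph ?G
    using assms(1) by (rule pair_graph_tableau_graph)
  obtain u where u: "awalk u p u" "distinct (tl (awalk_verts u p))" "p \<noteq> []" "3 \<le> length p"
    using cyc by (auto simp: undirected_cycle_def cycle_def)
  obtain a where a: "a \<in> set p" "a = (Row i, Col j) \<or> a = (Col j, Row i)"
    using c by (auto simp: walk_cells_def)
  then obtain p1 p2 where p: "p = p1 @ a # p2"
    by (meson split_list)
  define q where "q = p2 @ p1"
  have "cas u p u"
    using u(1) by auto
  then have dist: "distinct (map snd p)"
    using u(2,3) by (simp add: awalk_verts_conv')
  from u(1) have "awalk u p1 (fst a)" "awalk (snd a) p2 u" "a \<in> edges T"
    by (auto simp: p awalk_Cons_iff simp del: awalk_verts_with_proj_eq)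
  then have q: "awalk (snd a) q (fst a)"
    by (auto simp: q_def intro: awalk_appendI simp del: awalk_append_iff)
  have len: "2 \<le> length q"
    using u(4) by (simp add: p q_def)
  have "cas (snd a) q (fst a)"
    using q by auto
  moreover have "q \<noteq> []"
    using len by auto
  moreover have "tail ?G (hd q) = snd a"
    using calculation by (cases q) auto
  ultimately have "awalk_verts (snd a) q = snd a # map snd q"
    by (simp add: awalk_verts_conv')
  then have path: "apath (snd a) q (fst a)"
    using dist q by (auto simp: apath_def p q_def)
  \<comment> \<open>the reverse arc joins the two ends of the path, which would then consist of it alone\<close>
  have rev: "(snd a, fst a) \<notin> set q"
  proof
    assume "(snd a, fst a) \<in> set q"
    then obtain q1 q2 where q12: "q = q1 @ (snd a, fst a) # q2"
      by (meson split_list)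
    with path have "apath (snd a) q1 (snd a)" "apath (fst a) q2 (fst a)"
      by (auto simp: apath_append_iff apath_Cons_iff)
    then have "q1 = []" "q2 = []"
      using apath_nonempty_ends by blast+
    with q12 len show False
      by simp
  qed
  have "a \<notin> set q"
    using dist by (auto simp: p q_def)
  have sub: "set q \<subseteq> edges (walk_cells p - {(i, j)})"
  proof
    fix b
    assume b: "b \<in> set q"
    with q have "b \<in> edges T"
      by (auto simp: awalk_def)
    moreover have "b \<in> set p"
      using b by (auto simp: p q_def)
    ultimately show "b \<in> edges (walk_cells p - {(i, j)})"
      using a(2) rev \<open>a \<notin> set q\<close> b
      by (auto simp: edges_def walk_cells_def)
  qed
  have "(v, w) \<in> E\<^sup>*" if "cas v r w" "set r \<subseteq> E" for v w r and E :: "vertex rel"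
    using that by (induction r arbitrary: v) (auto intro: converse_rtrancl_into_rtrancl)
  with sub \<open>cas (snd a) q (fst a)\<close> have "(snd a, fst a) \<in> linked (walk_cells p - {(i, j)})"
    by blast
  then show ?thesis
    using a(2) symD[OF sym_linked] by auto
qed

lemma linked_closes_cycle:
  assumes sub: "insert (i, j) T \<subseteq> cells F" and "(i, j) \<notin> T" and lnk: "(Row i, Col j) \<in> linked T"
  shows "\<exists>p. undirected_cycle (tableau_graph F (insert (i, j) T)) p"
proof -
  let ?G = "tableau_graph F T" and ?H = "tableau_graph F (insert (i, j) T)"
  interpret G: pair_graph ?G
    using sub by (intro pair_graph_tableau_graph) (simp add: dotted_tableau_def)
  interpret H: pair_graph ?H
    using sub by (intro pair_graph_tableau_graph) (simp add: dotted_tableau_def)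
  have verts: "Row i \<in> pverts ?G" "Col j \<in> pverts ?G"
    using sub vertices_of_cell[of i j F] by auto
  then have "Row i \<rightarrow>\<^sup>*\<^bsub>with_proj ?G\<^esub> Col j"
    using lnk by (auto simp: G.reachable_conv arcs_ends_conv)
  then obtain p where p: "G.apath (Row i) p (Col j)"
    using G.reachable_awalk G.apath_awalk_to_apath by blast
  have "p \<noteq> []"
    using p by (auto simp: G.apath_Nil_iff)
  moreover have "p \<noteq> [b]" for b
    using p \<open>(i, j) \<notin> T\<close> by (cases b) (auto simp: G.apath_Cons_iff G.apath_Nil_iff)
  ultimately have "2 \<le> length p"
    by (cases p rule: remdups_adj.cases) auto
  moreover have "H.awalk (Row i) p (Col j)"
    using p edges_mono[of T "insert (i, j) T"]
    by (auto simp: G.apath_def G.awalk_def H.awalk_def)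
  then have "H.awalk (Col j) ((Col j, Row i) # p) (Col j)"
    by (simp add: H.awalk_Cons_iff)
  moreover have "distinct (tl (H.awalk_verts (Col j) ((Col j, Row i) # p)))"
    using p by (simp add: G.apath_def)
  ultimately have "undirected_cycle ?H ((Col j, Row i) # p)"
    unfolding undirected_cycle_def H.cycle_def by auto
  then show ?thesis
    by blast
qed

text \<open>
  Suppose that a cell \<open>c\<close> lies on the first cycle and not on the second. The second cycle, without
  \<open>e\<close>, links the ends of \<open>e\<close> inside \<open>T - {c}\<close>, so the part of the first cycle that links the ends of
  \<open>c\<close> can be rerouted around \<open>e\<close>. Then \<open>c\<close> closes a cycle in \<open>T\<close>. Equality of the two sets of
  cells follows by symmetry.
\<close>

lemma fundamental_cycle_unique:
  assumes sub: "insert e T \<subseteq> cells F" and acyc: "\<nexists>p. undirected_cycle (tableau_graph F T) p"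
    and p: "undirected_cycle (tableau_graph F (insert e T)) p"
    and q: "undirected_cycle (tableau_graph F (insert e T)) q"
  shows "walk_cells p \<subseteq> walk_cells q"
proof (rule ccontr)
  assume "\<not> walk_cells p \<subseteq> walk_cells q"
  then obtain i j where c: "(i, j) \<in> walk_cells p" "(i, j) \<notin> walk_cells q"
    by auto
  let ?c = "(i, j)" and ?S = "T - {(i, j)}"
  have dotted: "dotted_tableau F (insert e T)"
    using sub by (simp add: dotted_tableau_def)
  have "e \<in> walk_cells q"
    using q acyc walk_cells_subset[OF q] undirected_cycle_change[OF q, of T] by blast
  with c have "?c \<noteq> e" and "?c \<in> T"
    using walk_cells_subset[OF p] by auto
  \<comment> \<open>the second cycle joins the ends of e without using the cell c\<close>
  have "(Row (fst e), Col (snd e)) \<in> linked (walk_cells q - {e})"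
    using cycle_avoiding_edge_linked[OF dotted q, of "fst e" "snd e"] \<open>e \<in> walk_cells q\<close> by simp
  moreover have "walk_cells q - {e} \<subseteq> ?S"
    using walk_cells_subset[OF q] c by auto
  ultimately have e: "(Row (fst e), Col (snd e)) \<in> linked ?S"
    using linked_mono by blast
  have "(Row i, Col j) \<in> linked (walk_cells p - {?c})"
    using cycle_avoiding_edge_linked[OF dotted p] c by simp
  moreover have "walk_cells p - {?c} \<subseteq> insert e ?S"
    using walk_cells_subset[OF p] by auto
  ultimately have "(Row i, Col j) \<in> linked ?S"
    using linked_mono linked_insert[OF e] by blast
  moreover have T: "insert ?c ?S = T"
    using \<open>?c \<in> T\<close> by auto
  ultimately show False
    using linked_closes_cycle[of i j ?S F] acyc sub by auto
qed

lemma fundamental_cycle_eq: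
  assumes "insert e T \<subseteq> cells F" and "\<nexists>p. undirected_cycle (tableau_graph F T) p"
    and "undirected_cycle (tableau_graph F (insert e T)) p"
  shows "fundamental_cycle F T e = walk_cells p"
  unfolding fundamental_cycle_def
  by (rule the_equality)
    (use assms fundamental_cycle_unique[OF assms(1,2)] in blast)+

lemma fundamental_cycle_exists:
  assumes "insert e T \<subseteq> cells F" and "\<nexists>p. undirected_cycle (tableau_graph F T) p"
    and "e \<notin> T" and "(Row (fst e), Col (snd e)) \<in> linked T"
  obtains p where "undirected_cycle (tableau_graph F (insert e T)) p"
    and "fundamental_cycle F T e = walk_cells p" and "e \<in> walk_cells p"
proof -
  obtain p where p: "undirected_cycle (tableau_graph F (insert e T)) p"
    using linked_closes_cycle[of "fst e" "snd e" T F] assms by auto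
  have "e \<in> walk_cells p"
    using p assms(2) walk_cells_subset[OF p] undirected_cycle_change[OF p, of T] by blast
  with p fundamental_cycle_eq[OF assms(1,2) p] that show thesis
    by blast
qed

lemma rectangle_cycle:
  assumes "{(i, j), (i, j'), (i', j), (i', j')} \<subseteq> T" and "i \<noteq> i'" and "j \<noteq> j'"
    and "T \<subseteq> cells F"
  shows "\<exists>p. undirected_cycle (tableau_graph F T) p \<and>
    walk_cells p = {(i, j), (i, j'), (i', j), (i', j')}"
proof (intro exI conjI)
  let ?p = "[(Row i, Col j), (Col j, Row i'), (Row i', Col j'), (Col j', Row i)]"
  interpret pair_graph "tableau_graph F T"
    using assms(4) by (intro pair_graph_tableau_graph) (simp add: dotted_tableau_def)
  have "i \<in> rows F"
    using assms vertices_of_cell by blast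
  then have "awalk (Row i) ?p (Row i)"
    using assms by (auto simp: awalk_def)
  moreover have "distinct (tl (awalk_verts (Row i) ?p))"
    using assms(2,3) by simp
  ultimately have "cycle ?p"
    unfolding cycle_def by blast
  then show "undirected_cycle (tableau_graph F T) ?p"
    by (simp add: undirected_cycle_def)
  show "walk_cells ?p = {(i, j), (i, j'), (i', j), (i', j')}"
    unfolding walk_cells_def set_eq_iff split_paired_All mem_Collect_eq case_prod_conv
      list.set insert_iff empty_iff prod.inject vertex.inject vertex.distinct
    by (intro allI iffI; elim disjE conjE; clarsimp)
qed

section \<open>Branches of dotted tableaux\<close>

text \<open>
  The descendants of \<open>S\<close> for the parent relation given by the first dots of the rows and columns of
  \<open>T\<close>, where only the parent edges that belong to \<open>T'\<close> count. Being first refers to \<open>T\<close>, so deleting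
  edges cuts the forest without creating new parents.
\<close>

inductive_set branch :: "cell set \<Rightarrow> cell set \<Rightarrow> vertex set \<Rightarrow> vertex set"
  for T T' S where
  seed: "v \<in> S \<Longrightarrow> v \<in> branch T T' S"
| row: "(i, j) \<in> T' \<Longrightarrow> \<not> dot_left T (i, j) \<Longrightarrow> Col j \<in> branch T T' S \<Longrightarrow> Row i \<in> branch T T' S"
| col: "(i, j) \<in> T' \<Longrightarrow> \<not> dot_above T (i, j) \<Longrightarrow> Row i \<in> branch T T' S \<Longrightarrow> Col j \<in> branch T T' S"

text \<open>
  Every edge of \<open>T'\<close> is a parent edge, and none of them joins a vertex of \<open>S\<close> to a parent outside
  \<open>S\<close>. So the descendants are closed: an edge leads down to a descendant or up to a parent,
  and the parent of a descendant outside \<open>S\<close> is a descendant because it is the only parent.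
\<close>

lemma branch_closed:
  assumes "T' \<subseteq> T"
    and single: "\<And>c. c \<in> T' \<Longrightarrow> \<not> (dot_above T c \<and> dot_left T c)"
    and row_seed: "\<And>i j. (i, j) \<in> T' \<Longrightarrow> \<not> dot_left T (i, j) \<Longrightarrow> Row i \<in> S \<Longrightarrow> Col j \<in> S"
    and col_seed: "\<And>i j. (i, j) \<in> T' \<Longrightarrow> \<not> dot_above T (i, j) \<Longrightarrow> Col j \<in> S \<Longrightarrow> Row i \<in> S"
    and "(v, w) \<in> linked T'" and "v \<in> branch T T' S"
  shows "w \<in> branch T T' S"
proof -
  have first_row: "j = j'" if "(i, j) \<in> T'" "(i, j') \<in> T'" "\<not> dot_left T (i, j)" "\<not> dot_left T (i, j')"
    for i j j'
    using that \<open>T' \<subseteq> T\<close> by (auto simp: dot_left_def) (metis linorder_neqE_nat subsetD)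
  have first_col: "i = i'" if "(i, j) \<in> T'" "(i', j) \<in> T'" "\<not> dot_above T (i, j)" "\<not> dot_above T (i', j)"
    for i i' j
    using that \<open>T' \<subseteq> T\<close> by (auto simp: dot_above_def) (metis linorder_neqE_nat subsetD)
  have up_row: "Col j \<in> branch T T' S"
    if "Row i \<in> branch T T' S" "(i, j) \<in> T'" "\<not> dot_left T (i, j)" for i j
    using that(1)
  proof cases
    case seed
    then show ?thesis
      using row_seed that branch.seed by blast
  next
    case (row j')
    then show ?thesis
      using first_row that by metis
  qed
  have up_col: "Row i \<in> branch T T' S"
    if "Col j \<in> branch T T' S" "(i, j) \<in> T'" "\<not> dot_above T (i, j)" for i j
    using that(1)
  proof cases
    case seed
    then show ?thesis
      using col_seed that branch.seed by blast
  next
    case (col i')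
    then show ?thesis
      using first_col that by metis
  qed
  have step: "Row i \<in> branch T T' S \<longleftrightarrow> Col j \<in> branch T T' S" if "(i, j) \<in> T'" for i j
    using single[OF that] that up_row up_col branch.row branch.col by metis
  from assms(5,6) show ?thesis
    by induction (auto simp: edges_def step)
qed

text \<open>
  A dot \<open>(i, j)\<close> that is first in its row and in its column is its own parent edge at both ends.
  The descendants of these ends then form a component. It misses row 0 and column 0, whose
  parent edge is \<open>(0, 0)\<close>, and this contradicts connectedness.
\<close>

lemma exclusive_connected_imp_supported:
  assumes root: "(0, 0) \<in> T"
    and excl: "\<And>c. c \<in> T \<Longrightarrow> \<not> (dot_above T c \<and> dot_left T c)"
    and conn: "\<And>i j. (i, j) \<in> T \<Longrightarrow> (Row i, Row 0) \<in> linked T"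
    and c: "(i, j) \<in> T" "(i, j) \<noteq> (0, 0)"
  shows "dot_above T (i, j) \<or> dot_left T (i, j)"
proof (rule ccontr)
  assume "\<not> (dot_above T (i, j) \<or> dot_left T (i, j))"
  then have no: "\<not> dot_above T (i, j)" "\<not> dot_left T (i, j)"
    by auto
  let ?S = "{Row i, Col j}"
  have "Row 0 \<in> branch T T ?S"
  proof (rule branch_closed[OF subset_refl excl])
    show "Col b \<in> ?S" if "(a, b) \<in> T" "\<not> dot_left T (a, b)" "Row a \<in> ?S" for a b
      using that no(2) c(1) by (auto simp: dot_left_def) (metis linorder_neqE_nat)
    show "Row a \<in> ?S" if "(a, b) \<in> T" "\<not> dot_above T (a, b)" "Col b \<in> ?S" for a b
      using that no(1) c(1) by (auto simp: dot_above_def) (metis linorder_neqE_nat)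
    show "(Row i, Row 0) \<in> linked T"
      using conn c(1) .
    show "Row i \<in> branch T T ?S"
      by (simp add: branch.seed)
  qed
  moreover have "v \<noteq> Row 0 \<and> v \<noteq> Col 0" if "v \<in> branch T T ?S" for v
    using that
  proof induction
    case (seed v)
    have "i \<noteq> 0"
      using no(2) c root by (cases "i = 0") (auto simp: dot_left_def)
    moreover have "j \<noteq> 0"
      using no(1) c root by (cases "j = 0") (auto simp: dot_above_def)
    ultimately
    show ?case
      using seed by auto
  next
    case (row a b)
    then show ?case
      using root by (cases "a = 0") (auto simp: dot_left_def)
  next
    case (col a b)
    then show ?case
      using root by (cases "b = 0") (auto simp: dot_above_def)
  qed
  ultimately show False
    by blast
qed

section \<open>Tree-tableaux\<close>

lemma tree_tableau_supported:
  assumes "tree_tableau F T" "c \<in> T"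
  shows "\<not> (dot_above T c \<and> dot_left T c)"
    and "c \<noteq> (0, 0) \<Longrightarrow> dot_above T c \<or> dot_left T c"
proof -
  have step: "c \<noteq> (0, 0) \<longrightarrow> (dot_above T c \<or> dot_left T c) \<and> \<not> (dot_above T c \<and> dot_left T c)"
    using assms unfolding tree_tableau_def by blast
  moreover have "\<not> dot_left T (0, 0)"
    by (simp add: dot_left_def)
  ultimately show "\<not> (dot_above T c \<and> dot_left T c)"
    by blast
  show "c \<noteq> (0, 0) \<Longrightarrow> dot_above T c \<or> dot_left T c"
    using step by blast
qed

lemma first_dot_in_row:
  assumes "(i, j) \<in> T"
  obtains j' where "j' \<le> j" "(i, j') \<in> T" "\<not> dot_left T (i, j')"
proof (rule that)
  let ?P = "\<lambda>k. (i, k) \<in> T"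
  show "Least ?P \<le> j"
    by (rule Least_le[of ?P, OF assms])
  show "(i, Least ?P) \<in> T"
    by (rule LeastI[of ?P, OF assms])
  show "\<not> dot_left T (i, Least ?P)"
    by (auto simp: dot_left_def dest: not_less_Least)
qed

lemma first_dot_in_column:
  assumes "(i, j) \<in> T"
  obtains i' where "i' \<le> i" "(i', j) \<in> T" "\<not> dot_above T (i', j)"
proof (rule that)
  let ?P = "\<lambda>k. (k, j) \<in> T"
  show "Least ?P \<le> i"
    by (rule Least_le[of ?P, OF assms])
  show "(Least ?P, j) \<in> T"
    by (rule LeastI[of ?P, OF assms])
  show "\<not> dot_above T (Least ?P, j)"
    by (auto simp: dot_above_def dest: not_less_Least)
qed

text \<open>
  The first dot of row \<open>i > 0\<close> has nothing to its left, hence a dot above it; so two edges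
  lead from row \<open>i\<close> to an earlier row.
\<close>

lemma tree_tableau_linked:
  assumes "tree_tableau F T" and "v \<in> Row ` rows F \<union> Col ` columns F"
  shows "(v, Row 0) \<in> linked T"
proof -
  have rows: "(Row i, Row 0) \<in> linked T" if "i \<in> rows F" for i
    using that
  proof (induction i rule: less_induct)
    case (less i)
    obtain j0 where "(i, j0) \<in> T"
      using assms(1) less.prems by (auto simp: tree_tableau_def)
    then obtain j where j: "(i, j) \<in> T" "\<not> dot_left T (i, j)"
      by (rule first_dot_in_row)
    show ?case
    proof (cases "i = 0")
      case False
      then obtain i' where i': "i' < i" "(i', j) \<in> T"
        using tree_tableau_supported[OF assms(1) j(1)] j by (auto simp: dot_above_def)
      then have "(Row i', Row 0) \<in> linked T"
        using less by (auto simp: rows_def)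
      moreover have "(Row i, Col j) \<in> edges T" "(Col j, Row i') \<in> edges T"
        using j i' by auto
      ultimately show ?thesis
        by (meson converse_rtrancl_into_rtrancl)
    qed simp
  qed
  moreover have "(Col j, Row 0) \<in> linked T" if j: "j \<in> columns F" for j
  proof -
    obtain i where i: "(i, j) \<in> T"
      using assms(1) j by (auto simp: tree_tableau_def)
    then have "i \<in> rows F"
      using assms(1) by (auto simp: tree_tableau_def dotted_tableau_def intro: vertices_of_cell)
    with rows i show ?thesis
      by (meson converse_rtrancl_into_rtrancl edges_iff(2))
  qed
  ultimately show ?thesis
    using assms(2) by auto
qed

text \<open>
  Delete the dots weakly above and weakly to the left of \<open>(i, j)\<close> and follow parents. An ascent from
  row \<open>i\<close> cannot end at a column: as long as the dots used survive, their rows are at most \<open>i\<close>, so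
  their columns lie beyond \<open>j\<close>, and the first dot of such a column survives as well. It ends at a
  row \<open>r \<le> i\<close> whose first dot was deleted; these rows form the set \<open>S\<close> of the proof. By the same
  argument an ascent from column \<open>j\<close> ends at a column. So row \<open>i\<close> descends from \<open>S\<close> and
  column \<open>j\<close> does not.
\<close>

lemma quadrant_separates:
  assumes tt: "tree_tableau F T" and "i \<in> rows F"
  shows "(Row i, Col j) \<notin> linked {(a, b) \<in> T. \<not> (a \<le> i \<and> b \<le> j)}"
proof
  define T' where "T' = {(a, b) \<in> T. \<not> (a \<le> i \<and> b \<le> j)}"
  define S where "S = {Row r | r. r \<le> i \<and> (\<exists>b\<le>j. (r, b) \<in> T)}"
  assume "(Row i, Col j) \<in> linked {(a, b) \<in> T. \<not> (a \<le> i \<and> b \<le> j)}"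
  then have lnk: "(Row i, Col j) \<in> linked T'"
    by (simp add: T'_def)
  have T'_iff: "(a, b) \<in> T' \<longleftrightarrow> (a, b) \<in> T \<and> (i < a \<or> j < b)" for a b
    by (auto simp: T'_def)
  have row: "Row r \<in> branch T T' S" if "r \<le> i" for r
    using that
  proof (induction r rule: less_induct)
    case (less r)
    then have "r \<in> rows F"
      using assms(2) by (simp add: rows_def)
    then obtain b0 where "(r, b0) \<in> T"
      using tt by (auto simp: tree_tableau_def)
    then obtain b where b: "(r, b) \<in> T" "\<not> dot_left T (r, b)"
      by (rule first_dot_in_row)
    show ?case
    proof (cases "b \<le> j")
      case True
      with b less.prems show ?thesis
        by (auto simp: S_def intro: branch.seed)
    next
      case False
      then obtain r0 where r0: "r0 < r" "(r0, b) \<in> T"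
        using tree_tableau_supported(2)[OF tt b(1)] b(2) by (auto simp: dot_above_def)
      from r0(2) obtain r' where r': "r' \<le> r0" "(r', b) \<in> T" "\<not> dot_above T (r', b)"
        by (rule first_dot_in_column)
      have "Row r' \<in> branch T T' S"
        using less r' r0 by simp
      then have "Col b \<in> branch T T' S"
        by (rule branch.col[rotated 2]) (use r' False in \<open>simp_all add: T'_iff\<close>)
      then show ?thesis
        by (rule branch.row[rotated 2]) (use b False in \<open>simp_all add: T'_iff\<close>)
    qed
  qed
  have col: "Col c \<notin> branch T T' S" if "c \<le> j" for c
    using that
  proof (induction c rule: less_induct)
    case (less c)
    show ?case
    proof
      assume "Col c \<in> branch T T' S"
      then obtain r where r: "(r, c) \<in> T'" "\<not> dot_above T (r, c)" "Row r \<in> branch T T' S"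
        by cases (auto simp: S_def)
      then have "i < r" "(r, c) \<in> T"
        using less.prems by (auto simp: T'_iff)
      from r(3) obtain c' where c': "(r, c') \<in> T'" "\<not> dot_left T (r, c')" "Col c' \<in> branch T T' S"
        by cases (use \<open>i < r\<close> in \<open>auto simp: S_def\<close>)
      have "c' \<le> c"
        using c'(2) \<open>(r, c) \<in> T\<close> by (auto simp: dot_left_def not_less[symmetric])
      moreover have "dot_left T (r, c)"
        using tree_tableau_supported(2)[OF tt \<open>(r, c) \<in> T\<close>] r(2) \<open>i < r\<close> by auto
      ultimately have "c' < c"
        using c'(2) le_neq_implies_less by blast
      with less c'(3) show False
        by auto
    qed
  qed
  have "Col j \<in> branch T T' S"
  proof (rule branch_closed[OF _ _ _ _ lnk])
    show "T' \<subseteq> T"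
      by (auto simp: T'_def)
    then show "\<not> (dot_above T c \<and> dot_left T c)" if "c \<in> T'" for c
      using tree_tableau_supported(1)[OF tt] that by blast
    show "Col b \<in> S" if "(a, b) \<in> T'" "\<not> dot_left T (a, b)" "Row a \<in> S" for a b
      using that by (auto simp: S_def T'_iff dot_left_def)
    show "Row a \<in> S" if "Col b \<in> S" for a b
      using that by (simp add: S_def)
    show "Row i \<in> branch T T' S"
      by (simp add: row)
  qed
  with col show False
    by simp
qed

text \<open>
  The cell \<open>e\<close> may or may not have a dot. The case with a dot gives acyclicity of tree-tableaux, the
  other one external inactivity.
\<close>

lemma cycle_cell_below:
  assumes tt: "tree_tableau F T" and "dotted_tableau F U"
    and p: "undirected_cycle (tableau_graph F U) p"
    and e: "e \<in> walk_cells p" "walk_cells p - {e} \<subseteq> T"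
  shows "\<exists>c\<in>walk_cells p - {e}. fst c \<le> fst e \<and> snd c \<le> snd e"
proof (rule ccontr)
  assume none: "\<not> ?thesis"
  obtain i j where ij: "e = (i, j)"
    by (cases e)
  have "e \<in> cells F"
    using e walk_cells_subset[OF p] assms(2) by (auto simp: dotted_tableau_def)
  then have "i \<in> rows F"
    using ij vertices_of_cell by blast
  moreover have "walk_cells p - {e} \<subseteq> {(a, b) \<in> T. \<not> (a \<le> i \<and> b \<le> j)}"
  proof
    fix c
    assume "c \<in> walk_cells p - {e}"
    with none e(2) ij show "c \<in> {(a, b) \<in> T. \<not> (a \<le> i \<and> b \<le> j)}"
      by (cases c) force
  qed
  then have "(Row i, Col j) \<in> linked {(a, b) \<in> T. \<not> (a \<le> i \<and> b \<le> j)}"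
    using cycle_avoiding_edge_linked[OF assms(2) p, of i j] e(1) ij linked_mono by blast
  ultimately show False
    using quadrant_separates[OF tt] by blast
qed

text \<open>
  Take a dot of the cycle that minimizes the sum of its coordinates: the cycle contains no other dot
  weakly above and weakly to the left of it.
\<close>

lemma tree_tableau_acyclic:
  assumes tt: "tree_tableau F T"
  shows "\<nexists>p. undirected_cycle (tableau_graph F T) p"
proof
  assume "\<exists>p. undirected_cycle (tableau_graph F T) p"
  then obtain p where p: "undirected_cycle (tableau_graph F T) p" ..
  have dotted: "dotted_tableau F T"
    using tt by (simp add: tree_tableau_def)
  obtain e where e: "e \<in> walk_cells p"
    and min: "\<And>c. c \<in> walk_cells p \<Longrightarrow> fst e + snd e \<le> fst c + snd c"
    using walk_cells_nonempty[OF p]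
      ex_has_least_nat[of "\<lambda>c. c \<in> walk_cells p" _ "\<lambda>c. fst c + snd c"] by blast
  obtain c where "c \<in> walk_cells p" "c \<noteq> e" "fst c \<le> fst e" "snd c \<le> snd e"
    using cycle_cell_below[OF tt dotted p e] walk_cells_subset[OF p] by blast
  then show False
    using min[of c] by (auto simp: prod_eq_iff)
qed

section \<open>Compatible orders and external activity\<close>

lemma corner_in_cells:
  assumes "ferrers_diagram F" "(i, j) \<in> cells F" "i' \<le> i" "j' \<le> j"
  shows "(i', j') \<in> cells F"
proof -
  have "F ! i \<le> F ! i'"
    using assms by (cases "i' = i") (auto simp: ferrers_diagram_def cells_def sorted_wrt_iff_nth_less)
  with assms show ?thesis
    by (auto simp: cells_def)
qed

text \<open>
  Rows and columns suffice to compare the two cells: the cell in the row of \<open>c\<close> and the column of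
  \<open>e\<close> lies between them, and it belongs to the diagram because the diagram is a Ferrers diagram.
\<close>

lemma compatible_order_below:
  assumes "ferrers_diagram F" "F_compatible F R" "trans R"
    and "e \<in> cells F" "fst c \<le> fst e" "snd c \<le> snd e" "c \<noteq> e"
  shows "(c, e) \<in> R"
proof -
  obtain i j i' j' where e: "e = (i, j)" and c: "c = (i', j')"
    by (cases e, cases c)
  have cells: "(i', j') \<in> cells F" "(i', j) \<in> cells F" "(i, j) \<in> cells F"
    using assms corner_in_cells[OF assms(1)] e c by auto
  have right: "((i', j'), (i', j)) \<in> R" if "j' < j"
    using assms(2) cells that unfolding F_compatible_def by blast
  have down: "((i', j), (i, j)) \<in> R" if "i' < i"
    using assms(2) cells that unfolding F_compatible_def by blast
  consider "i' = i" "j' < j" | "i' < i" "j' = j" | "i' < i" "j' < j"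
    using assms(5-7) e c by fastforce
  then show ?thesis
    using right down e c transD[OF assms(3)] by cases blast+
qed

lemma external_activity_eq_0_iff:
  "external_activity F R T = 0 \<longleftrightarrow> (\<nexists>e. externally_active F R T e)"
proof -
  have "finite {e. externally_active F R T e}"
    by (rule finite_subset[OF _ finite_cells[of F]]) (auto simp: externally_active_def)
  then show ?thesis
    by (simp add: external_activity_def)
qed

lemma undirected_spanning_tree_tableau_iff:
  assumes "dotted_tableau F T"
  shows "undirected_spanning_tree (tableau_graph F T) (ferrers_graph F) \<longleftrightarrow>
    F \<noteq> [] \<and>
    (\<forall>u\<in>Row ` rows F \<union> Col ` columns F. \<forall>v\<in>Row ` rows F \<union> Col ` columns F. (u, v) \<in> linked T) \<and>
    (\<nexists>p. undirected_cycle (tableau_graph F T) p)"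
proof -
  interpret T: pair_graph "tableau_graph F T"
    using assms by (rule pair_graph_tableau_graph)
  interpret F: pair_graph "tableau_graph F (cells F)"
    by (rule pair_graph_tableau_graph) (simp add: dotted_tableau_def)
  have "edges T \<subseteq> edges (cells F)"
    using assms edges_mono by (simp add: dotted_tableau_def)
  then have "spanning (with_proj (tableau_graph F T)) (with_proj (ferrers_graph F))"
    by (auto simp: spanning_def subgraph_def ferrers_graph_def compatible_def
        T.wf_digraph_axioms F.wf_digraph_axioms)
  moreover have "Row ` rows F \<union> Col ` columns F \<noteq> {} \<longleftrightarrow> F \<noteq> []"
    by (auto simp: rows_def columns_def cells_def)
  ultimately show ?thesis
    unfolding undirected_spanning_tree_def undirected_tree_def
      connected_tableau_graph_iff[OF assms] by simp
qed

lemma tree_tableau_imp_inactive: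
  assumes "ferrers_diagram F" "strict_linear_order_on (cells F) R" "F_compatible F R"
    and tt: "tree_tableau F T"
  shows "\<not> externally_active F R T e"
proof
  assume act: "externally_active F R T e"
  have dotted: "T \<subseteq> cells F"
    using tt by (simp add: tree_tableau_def dotted_tableau_def)
  have e: "e \<in> cells F" "e \<notin> T"
    and min: "\<And>c. c \<in> fundamental_cycle F T e - {e} \<Longrightarrow> (e, c) \<in> R"
    using act by (auto simp: externally_active_def)
  have R: "trans R" "irrefl R"
    using assms(2) by (auto simp: strict_linear_order_on_def)
  have "fst e \<in> rows F" "snd e \<in> columns F"
    using e(1) vertices_of_cell[of "fst e" "snd e"] by auto
  then have "(Row (fst e), Row 0) \<in> linked T" "(Row 0, Col (snd e)) \<in> linked T"
    using tree_tableau_linked[OF tt] sym_linked[of T] by (auto dest: symD)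
  then have lnk: "(Row (fst e), Col (snd e)) \<in> linked T"
    by (rule rtrancl_trans)
  obtain p where p: "undirected_cycle (tableau_graph F (insert e T)) p"
      "fundamental_cycle F T e = walk_cells p" "e \<in> walk_cells p"
    using fundamental_cycle_exists[OF _ tree_tableau_acyclic[OF tt] e(2) lnk] e(1) dotted by auto
  obtain c where c: "c \<in> walk_cells p - {e}" "fst c \<le> fst e" "snd c \<le> snd e"
  proof -
    have "dotted_tableau F (insert e T)"
      using e(1) dotted by (simp add: dotted_tableau_def)
    moreover have "walk_cells p - {e} \<subseteq> T"
      using walk_cells_subset[OF p(1)] by blast
    ultimately show thesis
      using cycle_cell_below[OF tt _ p(1,3)] that by blast
  qed
  then have "(c, e) \<in> R"
    using compatible_order_below[OF assms(1,3) R(1) e(1)] by auto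
  moreover have "(e, c) \<in> R"
    using min c p(2) by simp
  ultimately show False
    using R by (meson irrefl_def transD)
qed

lemma inactive_spanning_tree_imp_tree_tableau:
  assumes ferrers: "ferrers_diagram F" and ord: "strict_linear_order_on (cells F) R" "F_compatible F R"
    and dotted: "dotted_tableau F T" and "F \<noteq> []"
    and lnk: "\<And>u v. u \<in> Row ` rows F \<union> Col ` columns F \<Longrightarrow> v \<in> Row ` rows F \<union> Col ` columns F \<Longrightarrow>
      (u, v) \<in> linked T"
    and acyc: "\<nexists>p. undirected_cycle (tableau_graph F T) p"
    and inactive: "\<nexists>e. externally_active F R T e"
  shows "tree_tableau F T"
proof -
  have T: "T \<subseteq> cells F"
    using dotted by (simp add: dotted_tableau_def)
  have trans: "trans R"
    using ord(1) by (simp add: strict_linear_order_on_def)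
  note below = compatible_order_below[OF ferrers ord(2) trans]
  have origin: "(0, 0) \<in> cells F"
    using ferrers \<open>F \<noteq> []\<close> by (cases F) (auto simp: ferrers_diagram_def cells_def)
  note origin_verts = vertices_of_cell[OF origin]
  have root: "(0, 0) \<in> T"
  proof (rule ccontr)
    assume no: "(0, 0) \<notin> T"
    have sub: "insert (0, 0) T \<subseteq> cells F"
      using origin T by auto
    obtain p where p: "undirected_cycle (tableau_graph F (insert (0, 0) T)) p"
        "fundamental_cycle F T (0, 0) = walk_cells p" "(0, 0) \<in> walk_cells p"
      using fundamental_cycle_exists[OF sub acyc no] lnk origin_verts by auto
    have "((0, 0), c) \<in> R" if "c \<in> walk_cells p - {(0, 0)}" for c
      using below[of c "(0, 0)"] that walk_cells_subset[OF p(1)] sub by auto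
    then have "externally_active F R T (0, 0)"
      using p no origin by (auto simp: externally_active_def)
    with inactive show False
      by blast
  qed
  have excl: "\<not> (dot_above T c \<and> dot_left T c)" if "c \<in> T" for c
  proof
    assume both: "dot_above T c \<and> dot_left T c"
    obtain i j where c: "c = (i, j)"
      by (cases c)
    with both obtain i' j' where corner: "i' < i" "(i', j) \<in> T" "j' < j" "(i, j') \<in> T"
      by (auto simp: dot_above_def dot_left_def)
    let ?e = "(i', j')"
    have e: "?e \<in> cells F"
      using corner_in_cells[OF ferrers, of i j] \<open>c \<in> T\<close> c T corner by auto
    have sub: "insert ?e T \<subseteq> cells F"
      using e T by auto
    obtain p where p: "undirected_cycle (tableau_graph F (insert ?e T)) p"
        "walk_cells p = {?e, (i', j), (i, j'), (i, j)}"
      using rectangle_cycle[of i' j' j i "insert ?e T" F] corner \<open>c \<in> T\<close> c sub by auto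
    have "?e \<notin> T"
    proof
      assume "?e \<in> T"
      then have "insert ?e T = T"
        by auto
      with p(1) acyc show False
        by auto
    qed
    moreover have "fundamental_cycle F T ?e = {?e, (i', j), (i, j'), (i, j)}"
      using fundamental_cycle_eq[OF sub acyc p(1)] p(2) by simp
    moreover have "(?e, d) \<in> R" if "d \<in> {(i', j), (i, j'), (i, j)}" for d
      using below[of d ?e] that corner T \<open>c \<in> T\<close> c by auto
    ultimately have "externally_active F R T ?e"
      using e by (auto simp: externally_active_def)
    with inactive show False
      by blast
  qed
  have conn: "(Row i, Row 0) \<in> linked T" if "(i, j) \<in> T" for i j
    using lnk that T vertices_of_cell[of i j F] origin_verts by auto
  have supp: "dot_above T c \<or> dot_left T c" if "c \<in> T" "c \<noteq> (0, 0)" for c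
  proof (cases c)
    case (Pair i j)
    show ?thesis
      unfolding Pair
      by (rule exclusive_connected_imp_supported[OF root]) (use excl conn that Pair in blast)+
  qed
  have "\<exists>j. (i, j) \<in> T" if "i \<in> rows F" for i
  proof -
    have "(Row i, Col 0) \<in> linked T"
      using lnk that origin_verts by auto
    then show ?thesis
      by (cases rule: converse_rtranclE) (auto simp: edges_def)
  qed
  moreover have "\<exists>i. (i, j) \<in> T" if "j \<in> columns F" for j
  proof -
    have "(Col j, Row 0) \<in> linked T"
      using lnk that origin_verts by auto
    then show ?thesis
      by (cases rule: converse_rtranclE) (auto simp: edges_def)
  qed
  ultimately show ?thesis
    using dotted root excl supp by (auto simp: tree_tableau_def)
qed

theorem theorem7p3:
  fixes F :: "nat list" and R :: "cell rel" and T :: "cell set"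
  assumes "ferrers_diagram F"
    and "R \<subseteq> cells F \<times> cells F" and "strict_linear_order_on (cells F) R"
    and "F_compatible F R"
    and "dotted_tableau F T"
  shows "tree_tableau F T \<longleftrightarrow>
           undirected_spanning_tree (tableau_graph F T) (ferrers_graph F) \<and>
           external_activity F R T = 0"
proof
  assume tt: "tree_tableau F T"
  have "F \<noteq> []"
    using tt by (auto simp: tree_tableau_def dotted_tableau_def cells_def)
  moreover have "(u, v) \<in> linked T"
    if "u \<in> Row ` rows F \<union> Col ` columns F" "v \<in> Row ` rows F \<union> Col ` columns F" for u v
    using tree_tableau_linked[OF tt] that sym_linked[of T] by (meson rtrancl_trans symD)
  ultimately show "undirected_spanning_tree (tableau_graph F T) (ferrers_graph F) \<and>
      external_activity F R T = 0"
    using tree_tableau_acyclic[OF tt] tree_tableau_imp_inactive[OF assms(1,3,4) tt]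
    by (simp add: undirected_spanning_tree_tableau_iff[OF assms(5)] external_activity_eq_0_iff)
next
  assume "undirected_spanning_tree (tableau_graph F T) (ferrers_graph F) \<and>
      external_activity F R T = 0"
  then show "tree_tableau F T"
    unfolding undirected_spanning_tree_tableau_iff[OF assms(5)] external_activity_eq_0_iff
    by (intro inactive_spanning_tree_imp_tree_tableau[OF assms(1,3,4,5)]) auto
qed

end
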